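(* Let $G$ be a finite group, and let $f:G \to \{\pm 1\}$ be a function with $\mathbb{E}_{x \in G} f(x) = 0$. Then \[ \Pr_{x,y}\,[f(x)f(y) = f(xy)] \le \frac{1}{2}\left(1 + \frac{1}{\sqrt{d}}\right), \] where $x,y$ are chosen uniformly and independently from $G$, and $d = \min_{\rho \ne 1} d_\rho$ is the minimum dimension of a nontrivial irreducible (complex) representation $\rho$ of $G$.
   Context: $d_\rho$ denotes the dimension of the representation $\rho$; the minimum is over nontrivial irreducible complex representations of $G$. $\mathbb{E}$ denotes the average over the uniform distribution on $G$. *)

theory Defs
  imports "HOL-Algebra.Group" "Jordan_Normal_Form.Matrix"
begin

definition is_rep :: "('a, 'b) monoid_scheme \<Rightarrow> nat \<Rightarrow> ('a \<Rightarrow> complex mat) \<Rightarrow> bool" where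
  "is_rep G n \<rho> \<longleftrightarrow>
     (\<forall>g\<in>carrier G. \<rho> g \<in> carrier_mat n n) \<and>
     (\<forall>g\<in>carrier G. \<forall>h\<in>carrier G. \<rho> (g \<otimes>\<^bsub>G\<^esub> h) = \<rho> g * \<rho> h) \<and>
     \<rho> \<one>\<^bsub>G\<^esub> = 1\<^sub>m n"

definition is_subspace_cn :: "nat \<Rightarrow> complex vec set \<Rightarrow> bool" where
  "is_subspace_cn n W \<longleftrightarrow> W \<subseteq> carrier_vec n \<and> 0\<^sub>v n \<in> W \<and>
     (\<forall>v\<in>W. \<forall>w\<in>W. v + w \<in> W) \<and> (\<forall>c. \<forall>v\<in>W. c \<cdot>\<^sub>v v \<in> W)"

definition is_irred_rep :: "('a, 'b) monoid_scheme \<Rightarrow> nat \<Rightarrow> ('a \<Rightarrow> complex mat) \<Rightarrow> bool" where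
  "is_irred_rep G n \<rho> \<longleftrightarrow> is_rep G n \<rho> \<and> n > 0 \<and>
     (\<forall>W. is_subspace_cn n W \<and> (\<forall>g\<in>carrier G. \<forall>v\<in>W. \<rho> g *\<^sub>v v \<in> W)
          \<longrightarrow> W = {0\<^sub>v n} \<or> W = carrier_vec n)"

text \<open>Nontrivial irreducible: irreducible and not the trivial representation
  (for an irreducible rep, all matrices being the identity forces n = 1).\<close>
definition is_nontriv_irred_rep :: "('a, 'b) monoid_scheme \<Rightarrow> nat \<Rightarrow> ('a \<Rightarrow> complex mat) \<Rightarrow> bool" where
  "is_nontriv_irred_rep G n \<rho> \<longleftrightarrow> is_irred_rep G n \<rho> \<and> \<not> (\<forall>g\<in>carrier G. \<rho> g = 1\<^sub>m n)"

definition min_nontriv_irrep_dim :: "('a, 'b) monoid_scheme \<Rightarrow> nat" where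
  "min_nontriv_irrep_dim G = Min {n. \<exists>\<rho>. is_nontriv_irred_rep G n \<rho>}"

end

theory Submission
  imports Defs "Jordan_Normal_Form.Determinant" "HOL-Analysis.Function_Topology"
    "HOL-Analysis.Topology_Euclidean_Space" "HOL-Analysis.Convex"
begin

text \<open>
  Let \<open>T\<close> be the operator \<open>(T u) x = (\<Sum>y. f (x y) u y)\<close> on complex functions on \<open>G\<close>,
  and let \<open>l\<close> be the maximum of \<open>\<parallel>T u\<parallel>\<^sup>2 / \<parallel>u\<parallel>\<^sup>2\<close>. By the parallelogram law the functions
  attaining this maximum form, together with \<open>0\<close>, a subspace \<open>W\<close>; it is invariant under
  translation because \<open>T\<close> intertwines left with right translation. If \<open>l > 0\<close> then \<open>W\<close>
  contains no nonzero constant, since \<open>T\<close> kills constants, so an irreducible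
  subrepresentation of \<open>W\<close> is nontrivial and has some dimension \<open>m \<ge> d\<close>. Summing Bessel's
  inequality for an orthonormal basis of it over the rows of \<open>T\<close>, each of squared norm \<open>|G|\<close>,
  gives \<open>m l \<le> |G|\<^sup>2\<close>. Hence \<open>\<langle>f, T f\<rangle> \<le> sqrt l |G| \<le> |G|\<^sup>2 / sqrt d\<close>, and the left-hand
  side is the sum of \<open>f x f y f (x y)\<close> over all \<open>x, y\<close>.
\<close>

section \<open>Orthonormal families of functions on a finite set\<close>

text \<open>Functions on \<open>S\<close> are total functions vanishing off \<open>S\<close>, so
  that equality of functions is equality on \<open>S\<close> and norm zero forces the zero
  function.\<close>

definition fspace :: "'i set \<Rightarrow> ('i \<Rightarrow> complex) set" where
  "fspace S = {u. \<forall>x. x \<notin> S \<longrightarrow> u x = 0}"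

definition ip :: "'i set \<Rightarrow> ('i \<Rightarrow> complex) \<Rightarrow> ('i \<Rightarrow> complex) \<Rightarrow> complex" where
  "ip S u v = (\<Sum>x\<in>S. u x * cnj (v x))"

definition sqn :: "'i set \<Rightarrow> ('i \<Rightarrow> complex) \<Rightarrow> real" where
  "sqn S u = (\<Sum>x\<in>S. (cmod (u x))\<^sup>2)"

definition lincomb :: "nat \<Rightarrow> (nat \<Rightarrow> complex) \<Rightarrow> (nat \<Rightarrow> 'i \<Rightarrow> complex) \<Rightarrow> 'i \<Rightarrow> complex" where
  "lincomb n c u = (\<lambda>x. \<Sum>i<n. c i * u i x)"

definition orthonormal :: "'i set \<Rightarrow> nat \<Rightarrow> (nat \<Rightarrow> 'i \<Rightarrow> complex) \<Rightarrow> bool" where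
  "orthonormal S n u \<longleftrightarrow> (\<forall>i<n. u i \<in> fspace S) \<and>
     (\<forall>i<n. \<forall>j<n. ip S (u i) (u j) = (if i = j then 1 else 0))"

definition fsubspace :: "'i set \<Rightarrow> ('i \<Rightarrow> complex) set \<Rightarrow> bool" where
  "fsubspace S V \<longleftrightarrow> V \<subseteq> fspace S \<and> (\<lambda>x. 0) \<in> V \<and>
     (\<forall>u\<in>V. \<forall>v\<in>V. (\<lambda>x. u x + v x) \<in> V) \<and> (\<forall>c. \<forall>u\<in>V. (\<lambda>x. c * u x) \<in> V)"

section \<open>Algebra of inner products and subspaces\<close>

lemma ip_self: "ip S u u = of_real (sqn S u)"
  by (simp add: ip_def sqn_def flip: complex_norm_square)

lemma ip_cnj: "cnj (ip S u v) = ip S v u"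
  by (simp add: ip_def mult.commute)

lemma ip_lincomb_left: "ip S (lincomb n c u) v = (\<Sum>i<n. c i * ip S (u i) v)"
proof -
  have "ip S (lincomb n c u) v = (\<Sum>x\<in>S. \<Sum>i<n. c i * (u i x * cnj (v x)))"
    by (simp add: ip_def lincomb_def sum_distrib_right mult.assoc)
  also have "\<dots> = (\<Sum>i<n. \<Sum>x\<in>S. c i * (u i x * cnj (v x)))"
    by (rule sum.swap)
  finally show ?thesis by (simp add: ip_def sum_distrib_left)
qed

lemma ip_lincomb_right: "ip S v (lincomb n c u) = (\<Sum>i<n. cnj (c i) * ip S v (u i))"
proof -
  have "ip S v (lincomb n c u) = cnj (\<Sum>i<n. c i * ip S (u i) v)"
    by (metis ip_cnj ip_lincomb_left)
  then show ?thesis by (simp add: ip_cnj)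
qed

lemma ip_diff_left: "ip S (\<lambda>x. u x - v x) w = ip S u w - ip S v w"
  by (simp add: ip_def algebra_simps sum_subtractf)

lemma ip_diff_right: "ip S w (\<lambda>x. u x - v x) = ip S w u - ip S w v"
  by (simp add: ip_def algebra_simps sum_subtractf)

lemma ip_scale_left: "ip S (\<lambda>x. c * u x) w = c * ip S u w"
  by (simp add: ip_def sum_distrib_left mult.assoc)

lemma sqn_scale: "sqn S (\<lambda>x. c * u x) = (cmod c)\<^sup>2 * sqn S u"
  by (simp add: sqn_def norm_mult power_mult_distrib sum_distrib_left)

lemma sqn_nonneg: "sqn S u \<ge> 0"
  by (simp add: sqn_def sum_nonneg)

lemma sqn_eq_0_iff:
  assumes "finite S" "u \<in> fspace S"
  shows "sqn S u = 0 \<longleftrightarrow> u = (\<lambda>x. 0)"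
  using assms by (auto simp: sqn_def fspace_def sum_nonneg_eq_0_iff fun_eq_iff)

text \<open>Needed to see that the maximizers of a norm ratio are closed under addition.\<close>

lemma parallelogram:
  "sqn S (\<lambda>x. u x + v x) + sqn S (\<lambda>x. u x - v x) = 2 * sqn S u + 2 * sqn S v"
proof -
  have "(cmod (a + b))\<^sup>2 + (cmod (a - b))\<^sup>2 = 2 * (cmod a)\<^sup>2 + 2 * (cmod b)\<^sup>2" for a b
    unfolding cmod_power2 by (simp add: power2_eq_square algebra_simps)
  then show ?thesis
    by (simp add: sqn_def sum_distrib_left flip: sum.distrib)
qed

lemma fspace_scale: "u \<in> fspace S \<Longrightarrow> (\<lambda>x. c * u x) \<in> fspace S"
  by (simp add: fspace_def)

lemma fspace_add: "u \<in> fspace S \<Longrightarrow> v \<in> fspace S \<Longrightarrow> (\<lambda>x. u x + v x) \<in> fspace S"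
  by (simp add: fspace_def)

lemma fspace_diff: "u \<in> fspace S \<Longrightarrow> v \<in> fspace S \<Longrightarrow> (\<lambda>x. u x - v x) \<in> fspace S"
  by (simp add: fspace_def)

lemma fspace_lincomb: "(\<And>i. i < n \<Longrightarrow> u i \<in> fspace S) \<Longrightarrow> lincomb n c u \<in> fspace S"
  by (simp add: fspace_def lincomb_def)

lemma fsubspace_add: "fsubspace S V \<Longrightarrow> u \<in> V \<Longrightarrow> v \<in> V \<Longrightarrow> (\<lambda>x. u x + v x) \<in> V"
  by (simp add: fsubspace_def)

lemma fsubspace_scale: "fsubspace S V \<Longrightarrow> u \<in> V \<Longrightarrow> (\<lambda>x. c * u x) \<in> V"
  by (simp add: fsubspace_def)

lemma fsubspace_lincomb:
  assumes "fsubspace S V" "\<And>i. i < n \<Longrightarrow> u i \<in> V"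
  shows "lincomb n c u \<in> V"
  using assms(2)
proof (induction n)
  case 0
  then show ?case using assms(1) by (simp add: lincomb_def fsubspace_def)
next
  case (Suc n)
  have "lincomb (Suc n) c u = (\<lambda>x. lincomb n c u x + (\<lambda>x. c n * u n x) x)"
    by (simp add: lincomb_def)
  then show ?case
    using Suc assms(1) unfolding fsubspace_def by simp
qed

lemma fsubspace_diff:
  assumes "fsubspace S V" "u \<in> V" "v \<in> V"
  shows "(\<lambda>x. u x - v x) \<in> V"
proof -
  have "(\<lambda>x. u x + (-1) * v x) \<in> V"
    by (intro fsubspace_add[OF assms(1,2)] fsubspace_scale[OF assms(1,3)])
  then show ?thesis by simp
qed

section \<open>Bessel's inequality and orthonormal bases\<close>

lemma ip_orthonormal_lincomb:
  assumes "orthonormal S n u" "j < n"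
  shows "ip S (lincomb n c u) (u j) = c j"
proof -
  have "ip S (lincomb n c u) (u j) = (\<Sum>i<n. if i = j then c i else 0)"
    unfolding ip_lincomb_left using assms by (intro sum.cong) (auto simp: orthonormal_def)
  then show ?thesis using assms by simp
qed

lemma ip_lincomb_lincomb:
  assumes "orthonormal S n u"
  shows "ip S (lincomb n a u) (lincomb n b u) = (\<Sum>i<n. a i * cnj (b i))"
  unfolding ip_lincomb_right
  by (intro sum.cong) (auto simp: ip_orthonormal_lincomb[OF assms])

text \<open>For the projection \<open>p\<close> of \<open>v\<close>, the products of
  \<open>p\<close> with \<open>v\<close> and with itself all equal the left-hand side, so it falls
  short of \<open>sqn S v\<close> by exactly the squared norm of \<open>v - p\<close>.\<close>

lemma bessel:
  assumes "orthonormal S n u"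
  shows "(\<Sum>i<n. (cmod (ip S v (u i)))\<^sup>2) \<le> sqn S v"
proof -
  define c where "c = (\<lambda>i. ip S v (u i))"
  define p where "p = lincomb n c u"
  have vp: "ip S v p = of_real (\<Sum>i<n. (cmod (c i))\<^sup>2)"
    by (simp add: p_def ip_lincomb_right c_def complex_norm_square mult.commute del: of_real_power)
  have pp: "ip S p p = of_real (\<Sum>i<n. (cmod (c i))\<^sup>2)"
    unfolding p_def ip_lincomb_lincomb[OF assms] by (simp add: complex_norm_square del: of_real_power)
  have pv: "ip S p v = of_real (\<Sum>i<n. (cmod (c i))\<^sup>2)"
    using vp by (metis ip_cnj complex_cnj_complex_of_real)
  have "of_real (sqn S (\<lambda>x. v x - p x)) = of_real (sqn S v) - complex_of_real (\<Sum>i<n. (cmod (c i))\<^sup>2)"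
    unfolding ip_self[symmetric] ip_diff_left ip_diff_right vp pp pv by simp
  then have "sqn S (\<lambda>x. v x - p x) = sqn S v - (\<Sum>i<n. (cmod (c i))\<^sup>2)"
    by (simp only: of_real_diff[symmetric] of_real_eq_iff)
  then show ?thesis using sqn_nonneg[of S "\<lambda>x. v x - p x"] by (simp add: c_def)
qed

lemma orthonormal_sqn: "orthonormal S n u \<Longrightarrow> i < n \<Longrightarrow> sqn S (u i) = 1"
  using ip_self[of S "u i"] by (simp add: orthonormal_def)

text \<open>The squared norms add up to \<open>n\<close>; summed point by point instead, each point
  of \<open>S\<close> contributes at most 1, by Bessel's inequality for its point mass.\<close>

lemma orthonormal_card:
  assumes "finite S" "orthonormal S n u"
  shows "n \<le> card S"
proof -
  have "real n = (\<Sum>i<n. sqn S (u i))"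
    using assms by (simp add: orthonormal_sqn)
  also have "\<dots> = (\<Sum>x\<in>S. \<Sum>i<n. (cmod (u i x))\<^sup>2)"
    unfolding sqn_def by (rule sum.swap)
  also have "\<dots> \<le> (\<Sum>x\<in>S. 1)"
  proof (rule sum_mono)
    fix x assume x: "x \<in> S"
    define e where "e = (\<lambda>y. if y = x then 1 else 0 :: complex)"
    have "ip S e w = cnj (w x)" for w
      using x assms(1) by (simp add: ip_def e_def if_distribR if_distrib[of "\<lambda>a. a * _"] cong: if_cong)
    moreover have "sqn S e = 1"
      using x assms(1) by (simp add: sqn_def e_def if_distrib[of cmod] if_distrib[of "\<lambda>a. a\<^sup>2"] cong: if_cong)
    ultimately show "(\<Sum>i<n. (cmod (u i x))\<^sup>2) \<le> 1"
      using bessel[OF assms(2), of e] by simp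
  qed
  finally show ?thesis by simp
qed

text \<open>One Gram-Schmidt step: the residual \<open>r\<close> is orthogonal to the family and
  gets normalized.\<close>

lemma orthonormal_extend:
  assumes "finite S" "orthonormal S n u" "v \<in> fspace S"
    and r: "r = (\<lambda>x. v x - lincomb n (\<lambda>i. ip S v (u i)) u x)"
    and "r \<noteq> (\<lambda>x. 0)"
  shows "orthonormal S (Suc n) (u(n := (\<lambda>x. of_real (1 / sqrt (sqn S r)) * r x)))"
proof -
  define w where "w = (\<lambda>x. of_real (1 / sqrt (sqn S r)) * r x)"
  have rS: "r \<in> fspace S" unfolding r
    using assms by (intro fspace_diff fspace_lincomb) (auto simp: orthonormal_def)
  then have pos: "sqn S r > 0"
    using assms sqn_eq_0_iff sqn_nonneg by (metis less_eq_real_def)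
  have ru: "ip S r (u j) = 0" if "j < n" for j
    unfolding r ip_diff_left ip_orthonormal_lincomb[OF assms(2) that] by simp
  have wu: "ip S w (u j) = 0" if "j < n" for j
    unfolding w_def ip_scale_left ru[OF that] by simp
  have uw: "ip S (u j) w = 0" if "j < n" for j
    using wu[OF that] by (metis ip_cnj complex_cnj_zero)
  have "sqn S w = 1" using pos unfolding w_def sqn_scale by (simp add: norm_divide power_divide)
  then have "ip S w w = 1" by (simp add: ip_self)
  moreover have "w \<in> fspace S" unfolding w_def by (rule fspace_scale[OF rS])
  ultimately show ?thesis
    using assms(2) uw wu unfolding w_def[symmetric] orthonormal_def
    by (auto simp: less_Suc_eq)
qed

text \<open>Orthonormal families in \<open>V\<close> have bounded size, so a largest one exists. A
  vector outside its span would have a nonzero residual, still in \<open>V\<close>, that enlarges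
  the family.\<close>

lemma orthonormal_basis_exists:
  assumes "finite S" "fsubspace S V"
  obtains n u where "orthonormal S n u" "\<And>i. i < n \<Longrightarrow> u i \<in> V"
    "\<And>v. v \<in> V \<Longrightarrow> v = lincomb n (\<lambda>i. ip S v (u i)) u"
proof -
  define P where "P = (\<lambda>n. \<exists>u. orthonormal S n u \<and> (\<forall>i<n. u i \<in> V))"
  have P0: "P 0" by (simp add: P_def orthonormal_def)
  have Pb: "n \<le> card S" if "P n" for n
    using that orthonormal_card[OF assms(1)] by (auto simp: P_def)
  define n where "n = Greatest P"
  have "P n" unfolding n_def by (rule GreatestI_nat[where P = P, OF P0 Pb])
  then obtain u where u: "orthonormal S n u" "\<And>i. i < n \<Longrightarrow> u i \<in> V"
    unfolding P_def by blast
  have "v = lincomb n (\<lambda>i. ip S v (u i)) u" if v: "v \<in> V" for v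
  proof (rule ccontr)
    assume neq: "v \<noteq> lincomb n (\<lambda>i. ip S v (u i)) u"
    define r where "r = (\<lambda>x. v x - lincomb n (\<lambda>i. ip S v (u i)) u x)"
    have r0: "r \<noteq> (\<lambda>x. 0)" using neq by (auto simp: r_def fun_eq_iff)
    have vS: "v \<in> fspace S" using v assms(2) by (auto simp: fsubspace_def)
    have rV: "r \<in> V" unfolding r_def
      by (intro fsubspace_diff[OF assms(2) v] fsubspace_lincomb[OF assms(2)] u(2))
    then have "(\<lambda>x. of_real (1 / sqrt (sqn S r)) * r x) \<in> V"
      by (rule fsubspace_scale[OF assms(2)])
    then have "P (Suc n)"
      using orthonormal_extend[OF assms(1) u(1) vS r_def r0] u(2) unfolding P_def
      by (intro exI conjI) (auto simp: less_Suc_eq)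
    then have "Suc n \<le> n" unfolding n_def by (rule Greatest_le_nat[where P = P, OF _ Pb])
    then show False by simp
  qed
  with u that show thesis by blast
qed

lemma orthonormal_full_spans:
  assumes "finite S" "orthonormal S (card S) u" "v \<in> fspace S"
  shows "v = lincomb (card S) (\<lambda>i. ip S v (u i)) u"
proof (rule ccontr)
  assume neq: "\<not> ?thesis"
  define r where "r = (\<lambda>x. v x - lincomb (card S) (\<lambda>i. ip S v (u i)) u x)"
  have "r \<noteq> (\<lambda>x. 0)" using neq by (auto simp: r_def fun_eq_iff)
  from orthonormal_card[OF assms(1) orthonormal_extend[OF assms r_def this]] show False by simp
qed

section \<open>Maximizers by compactness\<close>

text \<open>The squared norm of the image is continuous on the unit sphere, which is compact, so it
  attains a maximum \<open>l\<close>; quadratic scaling extends the bound to all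
  \<open>v\<close>.\<close>

lemma maximal_stretch_exists:
  fixes a :: "'j \<Rightarrow> 'i \<Rightarrow> complex"
  assumes "finite S" "S \<noteq> {}"
  obtains l u where "u \<in> fspace S" "sqn S u = 1" "sqn X (\<lambda>x. \<Sum>y\<in>S. a x y * u y) = l"
    "\<And>v. v \<in> fspace S \<Longrightarrow> sqn X (\<lambda>x. \<Sum>y\<in>S. a x y * v y) \<le> l * sqn S v"
proof -
  define F where "F = (\<lambda>u. sqn X (\<lambda>x. \<Sum>y\<in>S. a x y * u y))"
  \<comment> \<open>The index type may be infinite, so the coordinates off \<open>S\<close> are
    pinned to 0. Tychonoff's theorem makes \<open>K\<close> compact, and it contains the unit sphere
    of \<open>fspace S\<close>.\<close>
  define K where "K = (\<Pi>\<^sub>E y\<in>UNIV. if y \<in> S then cball (0::complex) 1 else {0})"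
  have "compactin (product_topology (\<lambda>i. euclidean) UNIV) K"
    unfolding K_def compactin_PiE by auto
  then have cK: "compact K" by (simp add: euclidean_product_topology)
  have coord: "continuous_on A (\<lambda>u::'i \<Rightarrow> complex. u y)" for A y
    by (rule continuous_on_subset[OF continuous_on_product_coordinates]) simp
  have "continuous_on UNIV (\<lambda>u::'i \<Rightarrow> complex. sqn S u)"
    unfolding sqn_def by (intro continuous_intros coord)
  then have "closed {u::'i \<Rightarrow> complex. sqn S u = 1}"
    by (intro closed_Collect_eq continuous_intros)
  then have cQ: "compact (K \<inter> {u. sqn S u = 1})" using cK by (rule compact_Int_closed[rotated])
  have mem: "u \<in> K" if "u \<in> fspace S" "sqn S u = 1" for u
  proof -
    have "cmod (u y) \<le> 1" if "y \<in> S" for y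
    proof -
      have "(cmod (u y))\<^sup>2 \<le> sqn S u" unfolding sqn_def
        by (rule member_le_sum) (use that assms in auto)
      then show ?thesis using \<open>sqn S u = 1\<close> by (simp add: power_le_one_iff abs_square_le_1)
    qed
    then show ?thesis using that by (auto simp: K_def fspace_def)
  qed
  obtain s where s: "s \<in> S" using assms by blast
  define e where "e = (\<lambda>y. if y = s then 1 else 0 :: complex)"
  have "sqn S e = 1"
    using s assms(1) by (simp add: sqn_def e_def if_distrib[of cmod] if_distrib[of "\<lambda>a. a\<^sup>2"] cong: if_cong)
  moreover have "e \<in> fspace S" using s by (auto simp: e_def fspace_def)
  ultimately have ne: "K \<inter> {u. sqn S u = 1} \<noteq> {}" using mem by blast
  have "continuous_on (K \<inter> {u. sqn S u = 1}) F"
    unfolding F_def sqn_def by (intro continuous_intros coord)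
  from continuous_attains_sup[OF cQ ne this] obtain u where
    u: "u \<in> K" "sqn S u = 1" and max: "\<And>v. v \<in> K \<Longrightarrow> sqn S v = 1 \<Longrightarrow> F v \<le> F u" by auto
  have uS: "u \<in> fspace S" using u(1) by (auto simp: K_def fspace_def PiE_iff split: if_splits)
  have scale: "F (\<lambda>x. c * v x) = (cmod c)\<^sup>2 * F v" for c v
    unfolding F_def sqn_scale[symmetric] by (simp add: sum_distrib_left algebra_simps)
  have "F v \<le> F u * sqn S v" if v: "v \<in> fspace S" for v
  proof (cases "v = (\<lambda>x. 0)")
    case True
    then show ?thesis by (simp add: F_def sqn_def)
  next
    case False
    then have pos: "sqn S v > 0"
      using v assms sqn_eq_0_iff sqn_nonneg by (metis less_eq_real_def)
    define c :: complex where "c = of_real (1 / sqrt (sqn S v))"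
    have c2: "(cmod c)\<^sup>2 = 1 / sqn S v" using pos by (simp add: c_def norm_divide power_divide)
    have "sqn S (\<lambda>x. c * v x) = 1" using pos by (simp add: sqn_scale c2)
    then have "F (\<lambda>x. c * v x) \<le> F u"
      using mem fspace_scale[OF v] max by blast
    then show ?thesis using pos by (simp add: scale c2 field_simps)
  qed
  then show thesis by (intro that[OF uS u(2) refl]) (simp add: F_def)
qed

text \<open>Used for dimension counting: if the \<open>k\<close> columns of \<open>A\<close> span
  the \<open>n\<close>-dimensional space, the columns of \<open>B\<close> hold the coefficients of
  the unit vectors.\<close>

lemma right_inverse_dim_le:
  fixes A B :: "complex mat"
  assumes A: "A \<in> carrier_mat n k" and B: "B \<in> carrier_mat k n" and AB: "A * B = 1\<^sub>m n"
  shows "n \<le> k"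
proof (rule ccontr)
  assume "\<not> n \<le> k"
  then have kn: "k < n" by simp
  \<comment> \<open>Padded to square matrices, \<open>A' B' = 1\<close> forces \<open>B' A' = 1\<close>, yet row \<open>k\<close> of \<open>B'\<close> is zero.\<close>
  define A' where "A' = Matrix.mat n n (\<lambda>(i,j). if j < k then A $$ (i,j) else 0)"
  define B' where "B' = Matrix.mat n n (\<lambda>(i,j). if i < k then B $$ (i,j) else 0)"
  have "A' * B' = 1\<^sub>m n"
  proof (rule eq_matI)
    fix i j assume "i < dim_row (1\<^sub>m n :: complex mat)" "j < dim_col (1\<^sub>m n :: complex mat)"
    then have ij: "i < n" "j < n" by auto
    have "(A' * B') $$ (i,j) = (\<Sum>l\<in>{0..<n}. A' $$ (i,l) * B' $$ (l,j))"
      using ij by (simp add: A'_def B'_def scalar_prod_def)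
    also have "\<dots> = (\<Sum>l\<in>{0..<k}. A $$ (i,l) * B $$ (l,j))"
      using ij kn by (intro sum.mono_neutral_cong_right) (auto simp: A'_def B'_def)
    also have "\<dots> = (A * B) $$ (i,j)"
      using ij A B by (simp add: scalar_prod_def)
    finally show "(A' * B') $$ (i,j) = 1\<^sub>m n $$ (i,j)" using AB by simp
  qed (simp_all add: A'_def B'_def)
  then have "B' * A' = 1\<^sub>m n"
    by (rule mat_mult_left_right_inverse[rotated 2]) (auto simp: A'_def B'_def)
  then have "(B' * A') $$ (k,k) = 1" using kn by simp
  moreover have "(B' * A') $$ (k,k) = 0"
    using kn by (simp add: A'_def B'_def scalar_prod_def)
  ultimately show False by simp
qed

section \<open>Irreducible representations inside function spaces\<close>

lemma (in group) sum_translate: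
  assumes "h \<in> carrier G"
  shows "(\<Sum>g\<in>carrier G. F (h \<otimes> g)) = (\<Sum>g\<in>carrier G. F g)"
proof -
  have "bij_betw (\<lambda>g. h \<otimes> g) (carrier G) (carrier G)"
    by (rule bij_betwI[where g = "\<lambda>g. inv h \<otimes> g"])
      (use assms in \<open>auto simp: m_assoc[symmetric]\<close>)
  then show ?thesis by (rule sum.reindex_bij_betw)
qed

lemma (in group) sum_translate_right:
  assumes "h \<in> carrier G"
  shows "(\<Sum>g\<in>carrier G. F (g \<otimes> h)) = (\<Sum>g\<in>carrier G. F g)"
proof -
  have "bij_betw (\<lambda>g. g \<otimes> h) (carrier G) (carrier G)"
    by (rule bij_betwI[where g = "\<lambda>g. g \<otimes> inv h"])
      (use assms in \<open>auto simp: m_assoc\<close>)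
  then show ?thesis by (rule sum.reindex_bij_betw)
qed

lemma mult_mat_vec_index_sum:
  "A \<in> carrier_mat n m \<Longrightarrow> v \<in> carrier_vec m \<Longrightarrow> i < n \<Longrightarrow>
    vec_index (A *\<^sub>v v) i = (\<Sum>j<m. A $$ (i,j) * vec_index v j)"
  by (auto simp: scalar_prod_def lessThan_atLeast0 intro!: sum.cong)

lemma mult_mat_index_sum:
  "A \<in> carrier_mat n m \<Longrightarrow> B \<in> carrier_mat m k \<Longrightarrow> i < n \<Longrightarrow> j < k \<Longrightarrow>
    (A * B) $$ (i,j) = (\<Sum>l<m. A $$ (i,l) * B $$ (l,j))"
  by (auto simp: scalar_prod_def lessThan_atLeast0 intro!: sum.cong)

text \<open>Needed because \<^const>\<open>Min\<close> is only meaningful on finite sets.\<close>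

lemma (in group) irred_rep_dim_le:
  assumes "finite (carrier G)" "is_irred_rep G n \<rho>"
  shows "n \<le> card (carrier G)"
proof -
  have car: "\<And>g. g \<in> carrier G \<Longrightarrow> \<rho> g \<in> carrier_mat n n"
    and mult: "\<And>g h. g \<in> carrier G \<Longrightarrow> h \<in> carrier G \<Longrightarrow> \<rho> (g \<otimes> h) = \<rho> g * \<rho> h"
    and one: "\<rho> \<one> = 1\<^sub>m n" and n0: "n > 0"
    and irr: "\<And>W. is_subspace_cn n W \<Longrightarrow> (\<forall>g\<in>carrier G. \<forall>v\<in>W. \<rho> g *\<^sub>v v \<in> W)
          \<Longrightarrow> W = {0\<^sub>v n} \<or> W = carrier_vec n"
    using assms(2) unfolding is_irred_rep_def is_rep_def by blast+
  \<comment> \<open>\<open>orb c\<close> is the combination of the vectors \<open>\<rho> g\<close>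
    applied to the first unit vector, so its range is the span of an orbit.\<close>
  define orb where "orb = (\<lambda>c. Matrix.vec n (\<lambda>i. \<Sum>g\<in>carrier G. c g * \<rho> g $$ (i,0)))"
  have "is_subspace_cn n (range orb)"
    unfolding is_subspace_cn_def
  proof (intro conjI ballI allI)
    show "range orb \<subseteq> carrier_vec n" by (auto simp: orb_def)
    have "0\<^sub>v n = orb (\<lambda>g. 0)" by (auto simp: orb_def)
    then show "0\<^sub>v n \<in> range orb" by blast
  next
    fix v w assume "v \<in> range orb" "w \<in> range orb"
    then obtain c d where "v = orb c" "w = orb d" by blast
    then have "v + w = orb (\<lambda>g. c g + d g)"
      by (auto simp: orb_def ring_distribs sum.distrib)
    then show "v + w \<in> range orb" by blast
  next
    fix a v assume "v \<in> range orb"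
    then obtain c where "v = orb c" by blast
    then have "a \<cdot>\<^sub>v v = orb (\<lambda>g. a * c g)"
      by (auto simp: orb_def sum_distrib_left mult.assoc)
    then show "a \<cdot>\<^sub>v v \<in> range orb" by blast
  qed
  moreover have "\<forall>g\<in>carrier G. \<forall>v\<in>range orb. \<rho> g *\<^sub>v v \<in> range orb"
  proof (intro ballI)
    fix h v assume h: "h \<in> carrier G" and "v \<in> range orb"
    then obtain c where v: "v = orb c" by blast
    have "\<rho> h *\<^sub>v v = orb (\<lambda>g. c (inv h \<otimes> g))"
    proof (rule eq_vecI)
      fix i assume "i < dim_vec (orb (\<lambda>g. c (inv h \<otimes> g)))"
      then have i: "i < n" by (simp add: orb_def)
      have "vec_index (\<rho> h *\<^sub>v v) i = (\<Sum>j<n. \<rho> h $$ (i,j) * (\<Sum>g\<in>carrier G. c g * \<rho> g $$ (j,0)))"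
        using mult_mat_vec_index_sum[OF car[OF h] _ i, of v] by (simp add: v orb_def)
      also have "\<dots> = (\<Sum>j<n. \<Sum>g\<in>carrier G. c g * (\<rho> h $$ (i,j) * \<rho> g $$ (j,0)))"
        by (simp add: sum_distrib_left algebra_simps)
      also have "\<dots> = (\<Sum>g\<in>carrier G. \<Sum>j<n. c g * (\<rho> h $$ (i,j) * \<rho> g $$ (j,0)))"
        by (rule sum.swap)
      also have "\<dots> = (\<Sum>g\<in>carrier G. c g * \<rho> (h \<otimes> g) $$ (i,0))"
        by (intro sum.cong refl)
          (simp add: mult[OF h] mult_mat_index_sum[OF car[OF h] car i n0] sum_distrib_left)
      also have "\<dots> = (\<Sum>g\<in>carrier G. c (inv h \<otimes> (h \<otimes> g)) * \<rho> (h \<otimes> g) $$ (i,0))"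
        using h by (intro sum.cong refl) (simp add: m_assoc[symmetric])
      also have "\<dots> = (\<Sum>g\<in>carrier G. c (inv h \<otimes> g) * \<rho> g $$ (i,0))"
        by (rule sum_translate[OF h])
      finally show "vec_index (\<rho> h *\<^sub>v v) i = vec_index (orb (\<lambda>g. c (inv h \<otimes> g))) i"
        using i by (simp add: orb_def)
    qed (use car[OF h] in \<open>auto simp: orb_def\<close>)
    then show "\<rho> h *\<^sub>v v \<in> range orb" by blast
  qed
  ultimately have cases: "range orb = {0\<^sub>v n} \<or> range orb = carrier_vec n" by (rule irr)
  \<comment> \<open>The point mass at \<open>\<one>\<close> yields the first unit vector itself, so
    the span is not zero and must be everything.\<close>
  have "vec_index (orb (\<lambda>g. if g = \<one> then 1 else 0)) 0 = 1"
    using n0 assms(1) one by (simp add: orb_def if_distrib[of "\<lambda>a. a * _"] cong: if_cong)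
  then have "orb (\<lambda>g. if g = \<one> then 1 else 0) \<noteq> 0\<^sub>v n" using n0 by auto
  then have full: "range orb = carrier_vec n" using cases by blast
  have "\<forall>j. \<exists>c. unit_vec n j = orb c"
    using full by (metis rangeE unit_vec_carrier)
  then obtain c where c: "\<And>j. unit_vec n j = orb (c j)" by metis
  obtain e where e: "bij_betw e {0..<card (carrier G)} (carrier G)"
    using ex_bij_betw_nat_finite[OF assms(1)] by blast
  let ?k = "card (carrier G)"
  \<comment> \<open>The columns of \<open>A\<close> are the orbit vectors, one for each group
    element; column \<open>j\<close> of \<open>B\<close> expresses \<open>unit_vec n j\<close>
    through them.\<close>
  define A where "A = Matrix.mat n ?k (\<lambda>(i,l). \<rho> (e l) $$ (i,0))"
  define B where "B = Matrix.mat ?k n (\<lambda>(l,j). c j (e l))"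
  have A: "A \<in> carrier_mat n ?k" and B: "B \<in> carrier_mat ?k n" by (auto simp: A_def B_def)
  have "A * B = 1\<^sub>m n"
  proof (rule eq_matI)
    fix i j assume "i < dim_row (1\<^sub>m n :: complex mat)" "j < dim_col (1\<^sub>m n :: complex mat)"
    then have ij: "i < n" "j < n" by auto
    have "(A * B) $$ (i,j) = (\<Sum>l\<in>{0..<?k}. c j (e l) * \<rho> (e l) $$ (i,0))"
      unfolding mult_mat_index_sum[OF A B ij] using ij
      by (simp add: A_def B_def lessThan_atLeast0 mult.commute)
    also have "\<dots> = (\<Sum>g\<in>carrier G. c j g * \<rho> g $$ (i,0))"
      by (rule sum.reindex_bij_betw[OF e])
    also have "\<dots> = vec_index (unit_vec n j) i" using ij by (simp add: c orb_def)
    finally show "(A * B) $$ (i,j) = 1\<^sub>m n $$ (i,j)" using ij by (simp add: unit_vec_def)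
  qed (simp_all add: A_def B_def)
  then show ?thesis by (rule right_inverse_dim_le[OF A B])
qed

section \<open>Left translation and invariant subspaces\<close>

text \<open>The inverse makes this a left action; the value 0 off the carrier keeps the result in
  \<open>fspace (carrier G)\<close>.\<close>

definition translate :: "('a, 'b) monoid_scheme \<Rightarrow> 'a \<Rightarrow> ('a \<Rightarrow> complex) \<Rightarrow> 'a \<Rightarrow> complex" where
  "translate G g u = (\<lambda>y. if y \<in> carrier G then u (inv\<^bsub>G\<^esub> g \<otimes>\<^bsub>G\<^esub> y) else 0)"

lemma translate_lincomb:
  "translate G g (lincomb n c u) = lincomb n c (\<lambda>i. translate G g (u i))"
  by (auto simp: translate_def lincomb_def fun_eq_iff)

lemma (in group) translate_mult:
  assumes "g \<in> carrier G" "h \<in> carrier G"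
  shows "translate G (g \<otimes> h) u = translate G g (translate G h u)"
  using assms by (auto simp: translate_def fun_eq_iff inv_mult_group m_assoc)

lemma (in group) translate_one: "u \<in> fspace (carrier G) \<Longrightarrow> translate G \<one> u = u"
  by (auto simp: translate_def fspace_def fun_eq_iff)

lemma lincomb_cong:
  assumes "\<And>i. i < n \<Longrightarrow> c i = d i" "\<And>i. i < n \<Longrightarrow> u i = v i"
  shows "lincomb n c u = lincomb n d v"
  using assms
  by (auto simp: lincomb_def intro!: sum.cong)

text \<open>Coefficient vectors are themselves functions of the index, so they can be combined by
  \<open>lincomb\<close> too; passing from coefficients to functions is linear.\<close>

lemma lincomb_lincomb_coeff:
  "lincomb m (lincomb k c w) u = lincomb k c (\<lambda>l. lincomb m (w l) u)"
proof
  fix x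
  have "lincomb m (lincomb k c w) u x = (\<Sum>i<m. \<Sum>l<k. c l * (w l i * u i x))"
    by (simp add: lincomb_def sum_distrib_right mult.assoc)
  also have "\<dots> = (\<Sum>l<k. \<Sum>i<m. c l * (w l i * u i x))" by (rule sum.swap)
  finally show "lincomb m (lincomb k c w) u x = lincomb k c (\<lambda>l. lincomb m (w l) u) x"
    by (simp add: lincomb_def sum_distrib_left)
qed

text \<open>The last clause ties the abstract matrices to actual translates, which is what later
  shows that the representation is nontrivial.\<close>

lemma (in group) irred_rep_in_invariant_subspace:
  assumes "finite (carrier G)" and W: "fsubspace (carrier G) W"
    and inv: "\<And>g w. g \<in> carrier G \<Longrightarrow> w \<in> W \<Longrightarrow> translate G g w \<in> W"
    and nz: "w0 \<in> W" "w0 \<noteq> (\<lambda>x. 0)"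
  obtains m u \<rho> where "m > 0" "orthonormal (carrier G) m u" "\<And>i. i < m \<Longrightarrow> u i \<in> W"
    "is_irred_rep G m \<rho>"
    "\<And>g j. g \<in> carrier G \<Longrightarrow> j < m \<Longrightarrow> translate G g (u j) = lincomb m (\<lambda>i. \<rho> g $$ (i,j)) u"
proof -
  let ?C = "carrier G"
  \<comment> \<open>Irreducibility comes from choosing an invariant orthonormal family of least positive size.\<close>
  define P where "P = (\<lambda>m. 0 < m \<and> (\<exists>u. orthonormal ?C m u \<and> (\<forall>i<m. u i \<in> W) \<and>
      (\<forall>g\<in>?C. \<forall>j<m. \<exists>c. translate G g (u j) = lincomb m c u)))"
  obtain n b where b: "orthonormal ?C n b" "\<And>i. i < n \<Longrightarrow> b i \<in> W"
    "\<And>v. v \<in> W \<Longrightarrow> v = lincomb n (\<lambda>i. ip ?C v (b i)) b"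
    using orthonormal_basis_exists[OF assms(1) W] by blast
  have "n > 0" using b(3)[OF nz(1)] nz(2) by (cases n) (auto simp: lincomb_def)
  then have "P n" unfolding P_def using b(1,2) b(3)[OF inv] by blast
  define m where "m = (LEAST m. P m)"
  have "P m" unfolding m_def by (rule LeastI[of P, OF \<open>P n\<close>])
  have m_le: "m \<le> k" if "P k" for k unfolding m_def by (rule Least_le[of P, OF that])
  obtain u where m0: "0 < m" and u: "orthonormal ?C m u" "\<And>i. i < m \<Longrightarrow> u i \<in> W"
    and uinv: "\<And>g j. g \<in> ?C \<Longrightarrow> j < m \<Longrightarrow> \<exists>c. translate G g (u j) = lincomb m c u"
    using \<open>P m\<close> unfolding P_def by blast
  \<comment> \<open>Orthonormality gives the matrix entries as inner products, so no coefficients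
    have to be chosen.\<close>
  define \<rho> where "\<rho> = (\<lambda>g. Matrix.mat m m (\<lambda>(i,j). ip ?C (translate G g (u j)) (u i)))"
  have car: "\<rho> g \<in> carrier_mat m m" for g by (simp add: \<rho>_def)
  have \<rho>_index: "\<rho> g $$ (i,j) = ip ?C (translate G g (u j)) (u i)" if "i < m" "j < m" for g i j
    using that by (simp add: \<rho>_def)
  have tr: "translate G g (u j) = lincomb m (\<lambda>i. \<rho> g $$ (i,j)) u" if "g \<in> ?C" "j < m" for g j
  proof -
    obtain c where c: "translate G g (u j) = lincomb m c u" using uinv \<open>g \<in> ?C\<close> \<open>j < m\<close> by blast
    have "\<rho> g $$ (i,j) = c i" if "i < m" for i
      using that \<open>j < m\<close> by (simp add: \<rho>_index c ip_orthonormal_lincomb[OF u(1)])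
    then show ?thesis unfolding c by (intro lincomb_cong) auto
  qed
  have rep: "is_rep G m \<rho>"
    unfolding is_rep_def
  proof (intro conjI ballI)
    show "\<rho> \<one> = 1\<^sub>m m"
    proof (rule eq_matI)
      fix i j assume "i < dim_row (1\<^sub>m m :: complex mat)" "j < dim_col (1\<^sub>m m :: complex mat)"
      then have ij: "i < m" "j < m" by auto
      have "translate G \<one> (u j) = u j"
        using u(1) ij by (intro translate_one) (auto simp: orthonormal_def)
      then show "\<rho> \<one> $$ (i,j) = 1\<^sub>m m $$ (i,j)"
        using u(1) ij by (auto simp: \<rho>_index orthonormal_def)
    qed (auto simp: \<rho>_def)
  next
    fix g h assume gh: "g \<in> ?C" "h \<in> ?C"
    show "\<rho> (g \<otimes> h) = \<rho> g * \<rho> h"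
    proof (rule eq_matI)
      fix i j assume "i < dim_row (\<rho> g * \<rho> h)" "j < dim_col (\<rho> g * \<rho> h)"
      then have ij: "i < m" "j < m" by (auto simp: \<rho>_def)
      have "\<rho> (g \<otimes> h) $$ (i,j) = ip ?C (translate G g (translate G h (u j))) (u i)"
        by (simp add: \<rho>_index ij translate_mult gh)
      also have "\<dots> = (\<Sum>k<m. \<rho> h $$ (k,j) * ip ?C (translate G g (u k)) (u i))"
        by (simp add: tr[OF gh(2) ij(2)] translate_lincomb ip_lincomb_left)
      also have "\<dots> = (\<rho> g * \<rho> h) $$ (i,j)"
        unfolding mult_mat_index_sum[OF car car ij]
        by (intro sum.cong) (auto simp: \<rho>_index[OF ij(1)] mult.commute)
      finally show "\<rho> (g \<otimes> h) $$ (i,j) = (\<rho> g * \<rho> h) $$ (i,j)" .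
    qed (auto simp: \<rho>_def)
  qed (rule car)
  have irr: "V = {0\<^sub>v m} \<or> V = carrier_vec m"
    if V: "is_subspace_cn m V" and Vinv: "\<forall>g\<in>?C. \<forall>v\<in>V. \<rho> g *\<^sub>v v \<in> V" for V
  proof -
    \<comment> \<open>\<open>fn\<close> carries \<open>V\<close> to functions on
      \<open>{..<m}\<close>, where orthonormal bases are available.\<close>
    define fn where "fn = (\<lambda>v :: complex Matrix.vec. \<lambda>i. if i < m then vec_index v i else 0)"
    have Vc: "V \<subseteq> carrier_vec m" and V0: "0\<^sub>v m \<in> V"
      and Vadd: "\<And>v w. v \<in> V \<Longrightarrow> w \<in> V \<Longrightarrow> v + w \<in> V"
      and Vscale: "\<And>c v. v \<in> V \<Longrightarrow> c \<cdot>\<^sub>v v \<in> V"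
      using V unfolding is_subspace_cn_def by blast+
    have fn_inj: "v = w" if "fn v = fn w" "v \<in> carrier_vec m" "w \<in> carrier_vec m" for v w
    proof (rule eq_vecI)
      fix i assume "i < dim_vec w"
      then show "vec_index v i = vec_index w i"
        using fun_cong[OF that(1), of i] that(2,3) by (simp add: fn_def)
    qed (use that in auto)
    have sub: "fsubspace {..<m} (fn ` V)"
      unfolding fsubspace_def
    proof (intro conjI ballI allI)
      show "fn ` V \<subseteq> fspace {..<m}" by (auto simp: fn_def fspace_def)
      have "(\<lambda>x. 0) = fn (0\<^sub>v m)" by (auto simp: fn_def)
      then show "(\<lambda>x. 0) \<in> fn ` V" using V0 by blast
    next
      fix a b assume "a \<in> fn ` V" "b \<in> fn ` V"
      then obtain v w where vw: "v \<in> V" "w \<in> V" "a = fn v" "b = fn w" by blast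
      have "v \<in> carrier_vec m" "w \<in> carrier_vec m" using vw Vc by auto
      then have "(\<lambda>x. a x + b x) = fn (v + w)" using vw by (auto simp: fn_def)
      then show "(\<lambda>x. a x + b x) \<in> fn ` V" using Vadd vw by blast
    next
      fix c a assume "a \<in> fn ` V"
      then obtain v where v: "v \<in> V" "a = fn v" by blast
      have "v \<in> carrier_vec m" using v Vc by auto
      then have "(\<lambda>x. c * a x) = fn (c \<cdot>\<^sub>v v)" using v by (auto simp: fn_def)
      then show "(\<lambda>x. c * a x) \<in> fn ` V" using Vscale v by blast
    qed
    obtain k w where w: "orthonormal {..<m} k w" "\<And>l. l < k \<Longrightarrow> w l \<in> fn ` V"
      "\<And>v. v \<in> fn ` V \<Longrightarrow> v = lincomb k (\<lambda>i. ip {..<m} v (w i)) w"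
      using orthonormal_basis_exists[OF finite_lessThan sub] by blast
    show ?thesis
    proof (cases "k = 0")
      case True
      have "v = 0\<^sub>v m" if "v \<in> V" for v
      proof (rule fn_inj)
        show "fn v = fn (0\<^sub>v m)"
          using w(3)[of "fn v"] that True by (auto simp: lincomb_def fn_def)
      qed (use that Vc in auto)
      then show ?thesis using V0 by blast
    next
      case False
      \<comment> \<open>\<open>u' l\<close> is the function with coordinate vector
        \<open>w l\<close>. Coordinates with respect to \<open>u\<close> preserve inner products, so
        \<open>u'\<close> is orthonormal; invariance of \<open>V\<close> makes its span invariant,
        and minimality of \<open>m\<close> applies to \<open>k\<close>.\<close>
      define u' where "u' = (\<lambda>l. lincomb m (w l) u)"
      have "orthonormal ?C k u'"
        using w(1) u(1) unfolding u'_def orthonormal_def ip_lincomb_lincomb[OF u(1)]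
        by (auto simp: ip_def intro!: fspace_lincomb)
      moreover have "\<forall>l<k. u' l \<in> W"
        unfolding u'_def using u(2) by (auto intro!: fsubspace_lincomb[OF W])
      moreover have "\<exists>c. translate G g (u' l) = lincomb k c u'" if g: "g \<in> ?C" and l: "l < k" for g l
      proof -
        obtain v where v: "v \<in> V" "w l = fn v" using w(2)[OF l] by blast
        have vc: "v \<in> carrier_vec m" using v Vc by auto
        have "fn (\<rho> g *\<^sub>v v) \<in> fn ` V" using Vinv g v by blast
        then obtain c where c: "fn (\<rho> g *\<^sub>v v) = lincomb k c w" using w(3) by blast
        have "translate G g (u' l) = lincomb m (w l) (\<lambda>j. lincomb m (\<lambda>i. \<rho> g $$ (i,j)) u)"
          unfolding u'_def translate_lincomb by (intro lincomb_cong tr g refl)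
        also have "\<dots> = lincomb m (lincomb m (w l) (\<lambda>j i. \<rho> g $$ (i,j))) u"
          by (simp only: lincomb_lincomb_coeff)
        also have "\<dots> = lincomb m (lincomb k c w) u"
        proof (rule lincomb_cong)
          fix i assume i: "i < m"
          then have "lincomb k c w i = (\<Sum>j<m. \<rho> g $$ (i,j) * vec_index v j)"
            unfolding c[symmetric] using mult_mat_vec_index_sum[OF car vc i] by (simp add: fn_def)
          then show "lincomb m (w l) (\<lambda>j i. \<rho> g $$ (i,j)) i = lincomb k c w i"
            by (simp add: lincomb_def v fn_def mult.commute)
        qed simp
        also have "\<dots> = lincomb k c u'" unfolding u'_def by (rule lincomb_lincomb_coeff)
        finally show ?thesis by blast
      qed
      ultimately have "P k" using False unfolding P_def by blast
      then have "m \<le> k" by (rule m_le)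
      moreover have "k \<le> m" using orthonormal_card[OF _ w(1)] by simp
      \<comment> \<open>Now \<open>w\<close> is a full orthonormal basis, so \<open>V\<close>
        contains every vector.\<close>
      ultimately have km: "k = card {..<m}" by simp
      have "v \<in> V" if v: "v \<in> carrier_vec m" for v
      proof -
        have "fn v \<in> fspace {..<m}" by (auto simp: fn_def fspace_def)
        then have "fn v = lincomb k (\<lambda>i. ip {..<m} (fn v) (w i)) w"
          using orthonormal_full_spans[OF finite_lessThan w(1)[unfolded km]] km by simp
        also have "\<dots> \<in> fn ` V" by (rule fsubspace_lincomb[OF sub w(2)])
        finally obtain v' where "v' \<in> V" "fn v = fn v'" by blast
        then show "v \<in> V" using fn_inj v Vc by blast
      qed
      then show ?thesis using Vc by blast
    qed
  qed
  have "is_irred_rep G m \<rho>" unfolding is_irred_rep_def using rep m0 irr by blast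
  from that[OF m0 u this tr] show thesis by blast
qed

section \<open>The mixing bound\<close>

lemma (in group) mixing_bound:
  fixes f :: "'a \<Rightarrow> real"
  assumes fin: "finite (carrier G)"
    and f1: "\<forall>x\<in>carrier G. f x = 1 \<or> f x = -1"
    and f0: "(\<Sum>x\<in>carrier G. f x) = 0"
  shows "(\<Sum>x\<in>carrier G. \<Sum>y\<in>carrier G. f x * f y * f (x \<otimes> y))
           \<le> real (card (carrier G)) ^ 2 / sqrt (real (min_nontriv_irrep_dim G))"
proof -
  let ?C = "carrier G"
  define N where "N = real (card ?C)"
  define d where "d = min_nontriv_irrep_dim G"
  \<comment> \<open>The kernel is \<open>f (x \<otimes> y)\<close> with no inverse, so translating
    the argument by \<open>g\<close> on the left turns \<open>T u x\<close> into
    \<open>T u (x \<otimes> g)\<close>.\<close>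
  define T where "T = (\<lambda>u x. \<Sum>y\<in>?C. complex_of_real (f (x \<otimes> y)) * u y)"
  obtain l u0 where u0: "u0 \<in> fspace ?C" "sqn ?C u0 = 1" "sqn ?C (T u0) = l"
    and max: "\<And>v. v \<in> fspace ?C \<Longrightarrow> sqn ?C (T v) \<le> l * sqn ?C v"
    using maximal_stretch_exists[OF fin carrier_not_empty, of ?C "\<lambda>x y. complex_of_real (f (x \<otimes> y))"]
    unfolding T_def by blast
  have l0: "l \<ge> 0" using u0(3) sqn_nonneg by blast
  have N0: "N \<ge> 0" by (simp add: N_def)
  have f2: "(f x)\<^sup>2 = 1" if "x \<in> ?C" for x using f1 that by fastforce

  have key: "real d * l \<le> N\<^sup>2 \<and> d > 0" if lpos: "l > 0"
  proof -
    \<comment> \<open>This is the top eigenspace of the adjoint of \<open>T\<close> composed with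
      \<open>T\<close>, described by norms alone.\<close>
    define W where "W = {u \<in> fspace ?C. sqn ?C (T u) = l * sqn ?C u}"
    have Tadd: "T (\<lambda>x. u x + v x) = (\<lambda>x. T u x + T v x)" for u v
      by (simp add: T_def ring_distribs sum.distrib)
    have Tdiff: "T (\<lambda>x. u x - v x) = (\<lambda>x. T u x - T v x)" for u v
      by (simp add: T_def ring_distribs sum_subtractf)
    have Tscale: "T (\<lambda>x. c * u x) = (\<lambda>x. c * T u x)" for c u
      by (simp add: T_def sum_distrib_left algebra_simps)
    have W: "fsubspace ?C W"
      unfolding fsubspace_def
    proof (intro conjI ballI allI)
      show "W \<subseteq> fspace ?C" by (auto simp: W_def)
      show "(\<lambda>x. 0) \<in> W" by (simp add: W_def T_def sqn_def fspace_def)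
    next
      fix c u assume "u \<in> W"
      then show "(\<lambda>x. c * u x) \<in> W" by (simp add: W_def Tscale sqn_scale fspace_scale)
    next
      fix u v assume uv: "u \<in> W" "v \<in> W"
      then have S: "u \<in> fspace ?C" "v \<in> fspace ?C" by (auto simp: W_def)
      let ?p = "\<lambda>x. u x + v x" and ?m = "\<lambda>x. u x - v x"
      have "sqn ?C (T ?p) + sqn ?C (T ?m) = 2 * (l * sqn ?C u) + 2 * (l * sqn ?C v)"
        unfolding Tadd Tdiff parallelogram using uv by (simp add: W_def)
      also have "\<dots> = l * (sqn ?C ?p + sqn ?C ?m)"
        unfolding parallelogram by (simp add: algebra_simps)
      \<comment> \<open>Neither term on the left exceeds its counterpart on the right, so equality
        of the sums forces equality in each.\<close>
      finally have "sqn ?C (T ?p) = l * sqn ?C ?p"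
        using max[OF fspace_add[OF S]] max[OF fspace_diff[OF S]] by (simp add: ring_distribs)
      then show "?p \<in> W" using fspace_add[OF S] by (simp add: W_def)
    qed
    have inv: "translate G g w \<in> W" if g: "g \<in> ?C" and w: "w \<in> W" for g w
    proof -
      have "T (translate G g w) x = T w (x \<otimes> g)" if x: "x \<in> ?C" for x
      proof -
        have "T (translate G g w) x = (\<Sum>y\<in>?C. complex_of_real (f (x \<otimes> g \<otimes> (inv g \<otimes> y))) * w (inv g \<otimes> y))"
          unfolding T_def translate_def using g x
          by (intro sum.cong) (auto simp: m_assoc inv_solve_left' simp flip: m_assoc[of g "inv g"])
        also have "\<dots> = T w (x \<otimes> g)"
          unfolding T_def using g by (intro sum_translate) simp
        finally show ?thesis .
      qed
      then have "sqn ?C (T (translate G g w)) = (\<Sum>x\<in>?C. (cmod (T w (x \<otimes> g)))\<^sup>2)"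
        by (simp add: sqn_def)
      also have "\<dots> = sqn ?C (T w)"
        unfolding sqn_def by (rule sum_translate_right[OF g])
      finally have 1: "sqn ?C (T (translate G g w)) = sqn ?C (T w)" .
      have "sqn ?C (translate G g w) = (\<Sum>x\<in>?C. (cmod (w (inv g \<otimes> x)))\<^sup>2)"
        by (simp add: sqn_def translate_def)
      also have "\<dots> = sqn ?C w"
        unfolding sqn_def using g by (intro sum_translate) simp
      finally show ?thesis using 1 w by (simp add: W_def fspace_def translate_def)
    qed
    have u0W: "u0 \<in> W" "u0 \<noteq> (\<lambda>x. 0)" using u0 by (auto simp: W_def sqn_def)
    obtain m u \<rho> where m0: "m > 0" and u: "orthonormal ?C m u" "\<And>i. i < m \<Longrightarrow> u i \<in> W"
      and irr: "is_irred_rep G m \<rho>"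
      and tr: "\<And>g j. g \<in> ?C \<Longrightarrow> j < m \<Longrightarrow> translate G g (u j) = lincomb m (\<lambda>i. \<rho> g $$ (i,j)) u"
      using irred_rep_in_invariant_subspace[OF fin W inv u0W] by blast
    have Tu: "sqn ?C (T (u i)) = l" if "i < m" for i
      using u(2)[OF that] orthonormal_sqn[OF u(1) that] by (simp add: W_def)
    have nontriv: "is_nontriv_irred_rep G m \<rho>"
      unfolding is_nontriv_irred_rep_def
    proof (intro conjI irr notI)
      \<comment> \<open>Then \<open>u 0\<close> is fixed by all translations, hence constant on the
        group. Since \<open>f\<close> sums to 0, \<open>T\<close> kills it, contradicting
        \<open>l > 0\<close>.\<close>
      assume id: "\<forall>g\<in>?C. \<rho> g = 1\<^sub>m m"
      have fixed: "translate G g (u 0) = u 0" if "g \<in> ?C" for g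
      proof -
        have "translate G g (u 0) = lincomb m (\<lambda>i. if i = 0 then 1 else 0) u"
          unfolding tr[OF that m0] using id that m0 by (intro lincomb_cong) auto
        then show ?thesis using m0 by (simp add: lincomb_def if_distrib[of "\<lambda>a. a * _"] cong: if_cong)
      qed
      have const: "u 0 y = u 0 \<one>" if "y \<in> ?C" for y
        using fun_cong[OF fixed[OF that], of y] that by (simp add: translate_def)
      have "T (u 0) x = 0" if "x \<in> ?C" for x
      proof -
        have "T (u 0) x = (\<Sum>y\<in>?C. complex_of_real (f (x \<otimes> y))) * u 0 \<one>"
          unfolding T_def sum_distrib_right by (intro sum.cong) (auto dest: const)
        also have "(\<Sum>y\<in>?C. complex_of_real (f (x \<otimes> y))) = complex_of_real (\<Sum>y\<in>?C. f y)"
          by (simp add: sum_translate[OF that, of "\<lambda>y. complex_of_real (f y)"])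
        finally show ?thesis by (simp add: f0)
      qed
      then have "sqn ?C (T (u 0)) = 0" by (simp add: sqn_def)
      then show False using Tu[OF m0] lpos by simp
    qed
    let ?D = "{n. \<exists>\<rho>. is_nontriv_irred_rep G n \<rho>}"
    have "?D \<subseteq> {..card ?C}"
      using irred_rep_dim_le[OF fin] by (auto simp: is_nontriv_irred_rep_def)
    then have finD: "finite ?D" using finite_subset by blast
    have mD: "m \<in> ?D" using nontriv by blast
    have dm: "d \<le> m" unfolding d_def min_nontriv_irrep_dim_def by (rule Min_le[OF finD mD])
    have "d \<in> ?D" unfolding d_def min_nontriv_irrep_dim_def using Min_in[OF finD] mD by blast
    then have d0: "d > 0" by (auto simp: is_nontriv_irred_rep_def is_irred_rep_def)
    have "real m * l = (\<Sum>i<m. sqn ?C (T (u i)))" by (simp add: Tu)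
    also have "\<dots> = (\<Sum>x\<in>?C. \<Sum>i<m. (cmod (T (u i) x))\<^sup>2)"
      unfolding sqn_def by (rule sum.swap)
    also have "\<dots> \<le> (\<Sum>x\<in>?C. N)"
    proof (rule sum_mono)
      fix x assume x: "x \<in> ?C"
      \<comment> \<open>As \<open>f\<close> is real, the conjugate of \<open>T v x\<close> is the
        inner product of row \<open>x\<close> with \<open>v\<close>, so Bessel's inequality bounds
        the sum over \<open>i\<close> by the squared norm of the row.\<close>
      define row where "row = (\<lambda>y. complex_of_real (f (x \<otimes> y)))"
      have "ip ?C row v = cnj (T v x)" for v
        by (simp add: ip_def T_def row_def)
      moreover have "sqn ?C row = N"
        using x by (simp add: sqn_def row_def f2 N_def)
      ultimately show "(\<Sum>i<m. (cmod (T (u i) x))\<^sup>2) \<le> N"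
        using bessel[OF u(1), of row] by simp
    qed
    also have "\<dots> = N\<^sup>2" by (simp add: N_def power2_eq_square)
    finally have "real m * l \<le> N\<^sup>2" .
    moreover have "real d * l \<le> real m * l" using dm l0 by (intro mult_right_mono) auto
    ultimately show ?thesis using d0 by linarith
  qed

  \<comment> \<open>\<open>f\<close> is arbitrary off the carrier and has to be cut off to lie in
    \<open>fspace\<close>.\<close>
  define F where "F = (\<lambda>x. if x \<in> ?C then complex_of_real (f x) else 0)"
  define t where "t = (\<lambda>x. \<Sum>y\<in>?C. f (x \<otimes> y) * f y)"
  have TF: "T F x = of_real (t x)" for x
    by (simp add: T_def F_def t_def)
  have sF: "sqn ?C F = N" by (simp add: sqn_def F_def f2 N_def)
  have "F \<in> fspace ?C" by (simp add: F_def fspace_def)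
  from max[OF this] have tl: "(\<Sum>x\<in>?C. (t x)\<^sup>2) \<le> l * N"
    unfolding sF by (simp add: sqn_def TF)
  define s where "s = (\<Sum>x\<in>?C. f x * t x)"
  have s: "(\<Sum>x\<in>?C. \<Sum>y\<in>?C. f x * f y * f (x \<otimes> y)) = s"
    by (simp add: s_def t_def sum_distrib_left algebra_simps)
  have "s\<^sup>2 \<le> (\<Sum>x\<in>?C. (f x)\<^sup>2) * (\<Sum>x\<in>?C. (t x)\<^sup>2)"
    unfolding s_def by (rule Cauchy_Schwarz_ineq_sum)
  also have "\<dots> = N * (\<Sum>x\<in>?C. (t x)\<^sup>2)" by (simp add: f2 N_def)
  also have "\<dots> \<le> N * (l * N)" by (intro mult_left_mono tl N0)
  finally have s2: "s\<^sup>2 \<le> l * N\<^sup>2" by (simp add: power2_eq_square mult.commute mult.left_commute)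
  have "s \<le> N\<^sup>2 / sqrt (real d)"
  \<comment> \<open>Positivity of \<open>d\<close> is known only for \<open>l > 0\<close>. For
    \<open>l = 0\<close> the sum \<open>s\<close> vanishes, and the right-hand side is nonnegative
    whatever \<open>d\<close> is.\<close>
  proof (cases "l = 0")
    case True
    then have "s = 0" using s2 by simp
    then show ?thesis by simp
  next
    case False
    then have k: "real d * l \<le> N\<^sup>2" "d > 0" using key l0 by auto
    have "l * N\<^sup>2 \<le> (N\<^sup>2 / real d) * N\<^sup>2"
      using k by (intro mult_right_mono) (auto simp: field_simps)
    then have "s\<^sup>2 \<le> (N\<^sup>2 / sqrt (real d))\<^sup>2"
      using s2 by (simp add: power_divide power2_eq_square)
    then show ?thesis by (rule power2_le_imp_le) simp
  qed
  then show ?thesis unfolding s N_def d_def .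
qed

section \<open>From the correlation sum to the probability\<close>

theorem theorem1:
  fixes G :: "('a, 'b) monoid_scheme" and f :: "'a \<Rightarrow> real"
  assumes "group G" and "finite (carrier G)"
    and "\<forall>x\<in>carrier G. f x = 1 \<or> f x = -1"
    and "(\<Sum>x\<in>carrier G. f x) = 0"
  shows "real (card {(x, y). x \<in> carrier G \<and> y \<in> carrier G \<and> f x * f y = f (x \<otimes>\<^bsub>G\<^esub> y)})
           / real (card (carrier G)) ^ 2
         \<le> 1 / 2 * (1 + 1 / sqrt (real (min_nontriv_irrep_dim G)))"
proof -
  interpret group G by fact
  let ?C = "carrier G"
  define N where "N = real (card ?C)"
  define D where "D = sqrt (real (min_nontriv_irrep_dim G))"
  define E where "E = {(x, y). x \<in> ?C \<and> y \<in> ?C \<and> f x * f y = f (x \<otimes>\<^bsub>G\<^esub> y)}"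
  define h where "h = (\<lambda>x y. f x * f y * f (x \<otimes>\<^bsub>G\<^esub> y))"
  have Npos: "N > 0" using assms(2) carrier_not_empty by (simp add: N_def card_gt_0_iff)
  have E: "E = {p \<in> ?C \<times> ?C. f (fst p) * f (snd p) = f (fst p \<otimes>\<^bsub>G\<^esub> snd p)}"
    by (auto simp: E_def)
  have "real (card E) = (\<Sum>p\<in>E. 1)" by simp
  also have "\<dots> = (\<Sum>p\<in>?C \<times> ?C. if f (fst p) * f (snd p) = f (fst p \<otimes>\<^bsub>G\<^esub> snd p) then 1 else 0)"
    unfolding E using assms(2) by (intro sum.inter_filter) simp
  \<comment> \<open>For signs \<open>a\<close>, \<open>b\<close>, \<open>c\<close> the product
    \<open>a * b * c\<close> is 1 if \<open>a * b = c\<close> and -1 otherwise.\<close>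
  also have "\<dots> = (\<Sum>p\<in>?C \<times> ?C. (1 + h (fst p) (snd p)) / 2)"
  proof (intro sum.cong refl)
    fix p assume "p \<in> ?C \<times> ?C"
    then have "fst p \<in> ?C" "snd p \<in> ?C" "fst p \<otimes>\<^bsub>G\<^esub> snd p \<in> ?C" by auto
    then have "f (fst p) = 1 \<or> f (fst p) = -1" "f (snd p) = 1 \<or> f (snd p) = -1"
      "f (fst p \<otimes>\<^bsub>G\<^esub> snd p) = 1 \<or> f (fst p \<otimes>\<^bsub>G\<^esub> snd p) = -1" using assms(3) by auto
    then show "(if f (fst p) * f (snd p) = f (fst p \<otimes>\<^bsub>G\<^esub> snd p) then 1 else 0)
        = (1 + h (fst p) (snd p)) / 2"
      unfolding h_def by (elim disjE) simp_all
  qed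
  also have "\<dots> = (N\<^sup>2 + (\<Sum>p\<in>?C \<times> ?C. h (fst p) (snd p))) / 2"
    by (simp add: sum.distrib N_def power2_eq_square card_cartesian_product flip: sum_divide_distrib)
  also have "(\<Sum>p\<in>?C \<times> ?C. h (fst p) (snd p)) = (\<Sum>x\<in>?C. \<Sum>y\<in>?C. h x y)"
    by (simp add: sum.cartesian_product split_def)
  also have "\<dots> \<le> N\<^sup>2 / D"
    using mixing_bound[OF assms(2-4)] by (simp add: h_def N_def D_def)
  finally have "real (card E) \<le> (N\<^sup>2 + N\<^sup>2 / D) / 2" by simp
  then have "real (card E) / N\<^sup>2 \<le> ((N\<^sup>2 + N\<^sup>2 / D) / 2) / N\<^sup>2"
    by (rule divide_right_mono) simp
  also have "\<dots> = 1 / 2 * (1 + 1 / D)"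
    using Npos by (simp add: add_divide_distrib)
  finally show ?thesis unfolding E_def N_def D_def .
qed

end
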